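(* Let $\mathbb{H}^3=\{(\tilde x^1,\tilde x^2,\tilde x^3)\in\mathbb{R}^3:\tilde x^3>0\}$ and let $(\mathbb{H}^3,\tilde F=\tilde\alpha^2/\tilde\beta)$ be the Kropina space where $\tilde\alpha=\frac{\sqrt{(d\tilde x^1)^2+(d\tilde x^2)^2+(d\tilde x^3)^2}}{\tilde x^3}$ is the hyperbolic metric and $\tilde\beta=\frac{b(\cos\theta\,d\tilde x^1+\sin\theta\,d\tilde x^2)}{(\tilde x^3)^2}$ is a $1$-form, with $b\neq0$ and $0\le\theta<2\pi$ constants. Let $\varphi:M^2\subset\mathbb{R}^2\to\mathbb{H}^3$ be an immersion given by $$\varphi(x^1,x^2)=(f(x^1)\cos x^2,\ f(x^1)\sin x^2,\ x^1),$$ where $f$ is a smooth positive real valued function defined on $\mathbb{R}_{>0}$. Then $\varphi$ cannot be minimal.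
   Context: Indices: $\epsilon,\eta$ range over $\{1,2\}$; $i,j$ range over $\{1,2,3\}$; repeated indices are summed. A Kropina metric $\tilde\alpha^2/\tilde\beta$ ($\tilde\alpha$ Riemannian, $\tilde\beta$ a $1$-form) is a conic Finsler metric, defined on directions with $\tilde\beta>0$. An immersion $\varphi:M^2\to(\mathbb{H}^3,\tilde F)$ induces $F(x,y)=\tilde F(\varphi(x),\varphi_*(y))$ on $M$. Put $z=(z^i_\epsilon)=\left(\frac{\partial\varphi^i}{\partial x^\epsilon}\right)$, $D^2_x(1)=\{(y^1,y^2)\in T_xM: F(x,y)<1\}$ (within the domain of the conic metric), and $$\mathcal F(x,z)=\frac{\mathrm{vol}(B^2(1))}{\mathrm{vol}(D^2_x(1))},$$ where $B^2(1)$ is the Euclidean unit ball and $\mathrm{vol}$ is Euclidean volume; $\mathcal F$ is regarded as a function of $\tilde x=\varphi(x)$ and of the matrix $z$. The mean curvature of $\varphi$ along a vector field $v=(v^i)$ on $\mathbb{H}^3$ is $$\mathcal H_\varphi(v)=\frac1{\mathcal F}\left\{\frac{\partial^2\mathcal F}{\partial z^i_\epsilon\partial z^j_\eta}\frac{\partial^2\varphi^j}{\partial x^\epsilon\partial x^\eta}+\frac{\partial^2\mathcal F}{\partial z^i_\epsilon\partial\tilde x^j}\frac{\partial\varphi^j}{\partial x^\epsilon}-\frac{\partial\mathcal F}{\partial\tilde x^i}\right\}v^i .$$ Since here $\tilde F$ does not depend on the base point, this reduces to $\mathcal H_\varphi(v)=\frac1{\mathcal F}\frac{\partial^2\mathcal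 F}{\partial z^i_\epsilon\partial z^j_\eta}\frac{\partial^2\varphi^j}{\partial x^\epsilon\partial x^\eta}v^i$. The immersion $\varphi$ is minimal if $\mathcal H_\varphi=0$ identically (for all $v$). *)

theory Defs
  imports "HOL-Analysis.Analysis"
begin

definition dir_deriv ::
    "'a::real_normed_vector \<Rightarrow> ('a \<Rightarrow> 'b::real_normed_vector) \<Rightarrow> 'a \<Rightarrow> 'b" where
  "dir_deriv u g p = vector_derivative (\<lambda>t. g (p + t *\<^sub>R u)) (at 0)"

text \<open>Partial derivatives are taken along coordinate unit vectors. A matrix \<open>z = (z\<^sup>i\<^sub>\<epsilon>)\<close> has
  type \<^typ>\<open>real^2^3\<close> with entries \<open>z $ i $ \<epsilon>\<close>, so the coordinate direction of the entry
  \<open>(i, \<epsilon>)\<close> is \<open>axis i (axis \<epsilon> 1)\<close>.\<close>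

abbreviation partial :: "'n::finite \<Rightarrow> (real^'n \<Rightarrow> 'b::real_normed_vector) \<Rightarrow> real^'n \<Rightarrow> 'b" where
  "partial i \<equiv> dir_deriv (axis i 1)"

abbreviation mpartial ::
    "3 \<Rightarrow> 2 \<Rightarrow> (real^2^3 \<Rightarrow> 'b::real_normed_vector) \<Rightarrow> real^2^3 \<Rightarrow> 'b" where
  "mpartial i \<epsilon> \<equiv> dir_deriv (axis i (axis \<epsilon> 1))"

primrec Ck_on ::
    "nat \<Rightarrow> 'a::euclidean_space set \<Rightarrow> ('a \<Rightarrow> 'b::real_normed_vector) \<Rightarrow> bool" where
  "Ck_on 0 S g \<longleftrightarrow> continuous_on S g"
| "Ck_on (Suc k) S g \<longleftrightarrow> g differentiable_on S \<and> (\<forall>u\<in>Basis. Ck_on k S (dir_deriv u g))"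

text \<open>Only meant for open \<open>S\<close>.\<close>

definition smooth_on :: "'a::euclidean_space set \<Rightarrow> ('a \<Rightarrow> 'b::real_normed_vector) \<Rightarrow> bool" where
  "smooth_on S g \<longleftrightarrow> (\<forall>k. Ck_on k S g)"

definition immersion ::
    "(real^2) set \<Rightarrow> (real^3) set \<Rightarrow> (real^2 \<Rightarrow> real^3) \<Rightarrow> bool" where
  "immersion M N \<phi> \<longleftrightarrow>
     \<phi> ` M \<subseteq> N \<and> smooth_on M \<phi> \<and> (\<forall>x\<in>M. inj (frechet_derivative \<phi> (at x)))"

text \<open>A conic Finsler metric on a subset of \<open>\<real>\<^sup>3\<close> is represented by a function \<open>F p y\<close> of the base
  point \<open>p\<close> and the tangent vector \<open>y\<close>, together with the set \<open>A p\<close> of directions at \<open>p\<close> on which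
  it is defined; values of \<open>F p\<close> outside \<open>A p\<close> are never used.\<close>

type_synonym finsler = "real^3 \<Rightarrow> real^3 \<Rightarrow> real"
type_synonym cone_field = "real^3 \<Rightarrow> (real^3) set"

definition kropina :: "finsler \<Rightarrow> finsler \<Rightarrow> finsler" where
  "kropina \<alpha> \<beta> p y = (\<alpha> p y)\<^sup>2 / \<beta> p y"

definition kropina_cone :: "finsler \<Rightarrow> cone_field" where
  "kropina_cone \<beta> p = {y. \<beta> p y > 0}"

text \<open>If \<open>z\<close> is the Jacobian matrix of \<open>\<phi>\<close> at \<open>x\<close> and \<open>p = \<phi> x\<close>, then \<open>z *v y\<close> is the push-forward
  of \<open>y\<close> and \<open>F p (z *v y)\<close> is the induced metric.\<close>

definition induced_cone :: "cone_field \<Rightarrow> real^3 \<Rightarrow> real^2^3 \<Rightarrow> (real^2) set" where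
  "induced_cone A p z = {y. z *v y \<in> A p}"

definition induced_disc :: "finsler \<Rightarrow> cone_field \<Rightarrow> real^3 \<Rightarrow> real^2^3 \<Rightarrow> (real^2) set" where
  "induced_disc F A p z = {y \<in> induced_cone A p z. F p (z *v y) < 1}"

definition area_density :: "finsler \<Rightarrow> cone_field \<Rightarrow> real^3 \<Rightarrow> real^2^3 \<Rightarrow> real" where
  "area_density F A p z =
     measure lborel (ball (0::real^2) 1) / measure lborel (induced_disc F A p z)"

definition jacobian_matrix :: "(real^2 \<Rightarrow> real^3) \<Rightarrow> real^2 \<Rightarrow> real^2^3" where
  "jacobian_matrix \<phi> x = (\<chi> i \<epsilon>. partial \<epsilon> (\<lambda>x'. \<phi> x' $ i) x)"

definition mean_curvature ::
    "finsler \<Rightarrow> cone_field \<Rightarrow> (real^2 \<Rightarrow> real^3) \<Rightarrow> (real^3 \<Rightarrow> real^3) \<Rightarrow> real^2 \<Rightarrow> real" where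
  "mean_curvature F A \<phi> v x =
     (let \<F> = area_density F A; p = \<phi> x; z = jacobian_matrix \<phi> x in
      1 / \<F> p z *
      (\<Sum>i\<in>UNIV.
         ((\<Sum>\<epsilon>\<in>UNIV. \<Sum>\<eta>\<in>UNIV. \<Sum>j\<in>UNIV.
             mpartial i \<epsilon> (mpartial j \<eta> (\<F> p)) z
             * partial \<epsilon> (partial \<eta> (\<lambda>x'. \<phi> x' $ j)) x)
        + (\<Sum>\<epsilon>\<in>UNIV. \<Sum>j\<in>UNIV.
             mpartial i \<epsilon> (\<lambda>z'. partial j (\<lambda>p'. \<F> p' z') p) z
             * partial \<epsilon> (\<lambda>x'. \<phi> x' $ j) x)
        - partial i (\<lambda>p'. \<F> p' z) p)
        * v p $ i))"

text \<open>At a point \<open>x\<close> whose tangent plane contains no admissible direction (for a Kropina metric: the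
  1-form \<open>\<beta>\<close> vanishes on the tangent plane) there is no induced metric, the disc is empty
  and the mean curvature is undefined. Minimality constrains only the remaining points.\<close>

definition minimal ::
    "finsler \<Rightarrow> cone_field \<Rightarrow> (real^2) set \<Rightarrow> (real^2 \<Rightarrow> real^3) \<Rightarrow> bool" where
  "minimal F A M \<phi> \<longleftrightarrow>
     (\<forall>v. \<forall>x\<in>M. induced_cone A (\<phi> x) (jacobian_matrix \<phi> x) \<noteq> {} \<longrightarrow>
        mean_curvature F A \<phi> v x = 0)"

definition H3 :: "(real^3) set" where
  "H3 = {p. p $ 3 > 0}"

definition hyp_alpha :: finsler where
  "hyp_alpha p y = sqrt ((y $ 1)\<^sup>2 + (y $ 2)\<^sup>2 + (y $ 3)\<^sup>2) / p $ 3"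

definition hyp_beta :: "real \<Rightarrow> real \<Rightarrow> finsler" where
  "hyp_beta b \<theta> p y = b * (cos \<theta> * y $ 1 + sin \<theta> * y $ 2) / (p $ 3)\<^sup>2"

definition rotation_surface :: "(real \<Rightarrow> real) \<Rightarrow> real^2 \<Rightarrow> real^3" where
  "rotation_surface f x = vector [f (x $ 1) * cos (x $ 2), f (x $ 1) * sin (x $ 2), x $ 1]"

end

theory Submission
  imports Defs
begin

text \<open>
  Write \<open>w = (cos \<theta>, sin \<theta>, 0)\<close>. The powers of the height in \<open>\<alpha>\<^sup>2\<close> and \<open>\<beta>\<close> cancel, so the Kropina
  metric is the translation invariant \<open>\<bar>y\<bar>\<^sup>2 / (b w \<bullet> y)\<close>. On a tangent plane spanned by the columns of \<open>z\<close>,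
  with normal vector \<open>n = z\<^sub>1 \<times> z\<^sub>2\<close>, its unit disc is the interior of an ellipse through the origin, and
  the area of this ellipse gives the density (\<open>area_density_kropina\<close>)
  \<open>\<F> = (4 / b\<^sup>2) \<Phi>(n)\<close> with \<open>\<Phi>(n) = \<bar>n\<bar>\<^sup>3 / (\<bar>n\<bar>\<^sup>2 - (w \<bullet> n)\<^sup>2)\<close>.
  Minimality is therefore the Euler-Lagrange equation of an anisotropic area functional whose integrand
  \<open>\<Phi>\<close> is positively homogeneous of degree one (\<open>mean_curvature_kropina\<close>).

  For a surface of rotation with profile \<open>f\<close>, the variation in the radial direction turns this equation into
  \<open>f f'' D\<^sup>2\<Phi>(e\<^sub>3, e\<^sub>3) = D\<^sup>2\<Phi>(e\<^sub>s, e\<^sub>s)\<close> at the vector \<open>N = e\<^sub>r - f' e\<^sub>3\<close>, where \<open>e\<^sub>r\<close>, \<open>e\<^sub>s\<close>,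
  \<open>e\<^sub>3\<close> are the radial, angular and axial unit vectors (\<open>euler_lagrange_rotation\<close>). After
  clearing denominators this is a quadratic equation in \<open>C = cos\<^sup>2 (x\<^sub>2 - \<theta>)\<close> with coefficients that depend
  on \<open>\<rho> = 1 + f'\<^sup>2\<close> and \<open>\<kappa> = f f''\<close> only, hence are constant along each parallel \<open>x\<^sub>1 = t\<close>.

  The domain is open, so \<open>x\<^sub>2\<close> runs through an interval on the parallel, and \<open>C\<close> takes more than two values
  at points where the metric is defined. All three coefficients must vanish. The constant one forces
  \<open>\<kappa> = 3 \<rho>\<close> and the leading one forces \<open>\<kappa> = - \<rho>\<close>, which contradicts \<open>\<rho> \<ge> 1\<close>.
\<close>

section \<open>The area of an elliptic disc through the origin\<close>

lemma vec2_eq_iff: "(x::'a^2) = y \<longleftrightarrow> x $ 1 = y $ 1 \<and> x $ 2 = y $ 2"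
  by (simp add: vec_eq_iff forall_2)

text \<open>For a positive definite form in triangular shape, the coordinates
  \<open>u = (e y\<^sub>1 + k y\<^sub>2, g y\<^sub>2)\<close> turn the set into \<open>\<bar>u\<bar>\<^sup>2 < d \<bullet> u\<close>, which is the ball with centre
  \<open>d / 2\<close> and radius \<open>\<bar>d\<bar> / 2\<close>; the Jacobian of the change of coordinates is \<open>e g\<close>.\<close>

lemma measure_elliptic_disc_triangular:
  fixes e k g c1 c2 :: real
  assumes "e > 0" "g > 0"
  defines "d2 \<equiv> (c2 - k * (c1 / e)) / g"
  shows "measure lborel {y::real^2. (e * y$1 + k * y$2)\<^sup>2 + (g * y$2)\<^sup>2 < c1 * y$1 + c2 * y$2}
         = unit_ball_vol 2 * ((c1 / e)\<^sup>2 + d2\<^sup>2) / (4 * e * g)"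
proof -
  define d :: "real^2" where "d = vector [c1 / e, d2]"
  define L :: "real^2 \<Rightarrow> real^2" where "L u = vector [(u$1 - k * (u$2 / g)) / e, u$2 / g]" for u
  let ?B = "ball ((1/2) *\<^sub>R d) (norm d / 2)"
  let ?S = "{y::real^2. (e * y$1 + k * y$2)\<^sup>2 + (g * y$2)\<^sup>2 < c1 * y$1 + c2 * y$2}"
  have lin: "linear L"
    by (rule linearI) (simp_all add: L_def vec2_eq_iff add_divide_distrib diff_divide_distrib algebra_simps)
  have det: "det (matrix L) = 1 / (e * g)"
    using assms by (simp add: det_2 matrix_def L_def axis_def)
  have norm2: "(norm u)\<^sup>2 = (u$1)\<^sup>2 + (u$2)\<^sup>2" for u :: "real^2"
    by (simp add: norm_vec_def L2_set_def sum_2)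
  then have normd: "(norm d)\<^sup>2 = (c1 / e)\<^sup>2 + d2\<^sup>2"
    by (simp add: d_def)
  have pow2_less: "x\<^sup>2 < r\<^sup>2 \<longleftrightarrow> x < r" if "x \<ge> 0" "r \<ge> 0" for x r :: real
    using that by (meson power2_less_imp_less power_strict_mono pos2)
  have ball_iff: "u \<in> ?B \<longleftrightarrow> (u$1)\<^sup>2 + (u$2)\<^sup>2 < c1 / e * u$1 + d2 * u$2" for u :: "real^2"
  proof -
    have "u \<in> ?B \<longleftrightarrow> (norm (u - (1/2) *\<^sub>R d))\<^sup>2 < (norm d / 2)\<^sup>2"
      using pow2_less[of "norm (u - (1/2) *\<^sub>R d)" "norm d / 2"]
      by (simp add: dist_norm norm_minus_commute)
    moreover have "(norm (u - (1/2) *\<^sub>R d))\<^sup>2 - (norm d / 2)\<^sup>2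
        = (u$1)\<^sup>2 + (u$2)\<^sup>2 - (c1 / e * u$1 + d2 * u$2)"
      unfolding power_divide norm2 by (simp add: d_def power2_diff power_divide algebra_simps)
    ultimately show ?thesis
      by (smt (verit))
  qed
  have L_iff: "L u \<in> ?S \<longleftrightarrow> u \<in> ?B" for u
  proof -
    have "e * L u $ 1 + k * L u $ 2 = u $ 1" "g * L u $ 2 = u $ 2"
      using assms by (simp_all add: L_def)
    moreover have "c1 * L u $ 1 + c2 * L u $ 2 = c1 / e * u$1 + d2 * u$2"
      using assms by (simp add: L_def d2_def field_simps)
    ultimately show ?thesis
      by (simp only: ball_iff mem_Collect_eq)
  qed
  have "y \<in> L ` ?B" if "y \<in> ?S" for y
  proof -
    have y: "y = L (vector [e * y$1 + k * y$2, g * y$2])" (is "_ = L ?u")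
      using assms by (simp add: L_def vec2_eq_iff)
    have "L ?u \<in> ?S"
      using that by (simp only: y[symmetric])
    then show ?thesis
      using y L_iff by (intro image_eqI) blast+
  qed
  then have "?S = L ` ?B" using L_iff by blast
  moreover have "open ?S"
    by (intro open_Collect_less continuous_intros)
  ultimately have "measure lborel ?S = measure lebesgue (L ` ?B)"
    by (simp add: measure_completion borel_open)
  also have "\<dots> = 1 / (e * g) * measure lborel ?B"
    using assms by (simp add: measure_linear_image[OF lin] det)
  also have "\<dots> = unit_ball_vol 2 * ((c1 / e)\<^sup>2 + d2\<^sup>2) / (4 * e * g)"
    unfolding normd[symmetric] by (simp add: content_ball power_divide)
  finally show ?thesis .
qed

text \<open>The Cholesky factorisation brings a general positive definite form into the triangular shape.
  The factor \<open>unit_ball_vol 2\<close> is kept unevaluated since it cancels in the area density.\<close>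

lemma measure_elliptic_disc:
  fixes E F H c1 c2 :: real
  assumes "E > 0" and D: "E * H - F\<^sup>2 > 0"
  shows "measure lborel {y::real^2. E * (y$1)\<^sup>2 + 2 * F * y$1 * y$2 + H * (y$2)\<^sup>2 < c1 * y$1 + c2 * y$2}
         = unit_ball_vol 2 * (H * c1\<^sup>2 - 2 * F * c1 * c2 + E * c2\<^sup>2) / (4 * (sqrt (E * H - F\<^sup>2)) ^ 3)"
proof -
  \<comment> \<open>The Cholesky factor of the form has rows \<open>(e, k)\<close> and \<open>(0, g)\<close>.\<close>
  define e k g where "e = sqrt E" and "k = F / e" and "g = sqrt ((E * H - F\<^sup>2) / E)"
  have pos: "e > 0" "g > 0" using assms by (simp_all add: e_def g_def)
  have e2: "E = e\<^sup>2" using assms by (simp add: e_def)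
  have F: "F = e * k" using pos by (simp add: k_def)
  have "g\<^sup>2 = (E * H - F\<^sup>2) / E" using assms by (simp add: g_def)
  moreover have "(E * H - F\<^sup>2) / E = H - k\<^sup>2"
    using pos by (simp add: e2 F diff_divide_distrib power_mult_distrib)
  ultimately have "g\<^sup>2 = H - k\<^sup>2"
    by simp
  then have H: "H = k\<^sup>2 + g\<^sup>2" by simp
  have "E * H - F\<^sup>2 = (e * g)\<^sup>2"
    by (simp add: e2 F H algebra_simps power_mult_distrib)
  then have rD: "sqrt (E * H - F\<^sup>2) = e * g"
    using pos by simp
  have "E * (y$1)\<^sup>2 + 2 * F * y$1 * y$2 + H * (y$2)\<^sup>2 = (e * y$1 + k * y$2)\<^sup>2 + (g * y$2)\<^sup>2"
    for y :: "real^2"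
    by (simp add: e2 F H power2_eq_square algebra_simps)
  moreover have "unit_ball_vol 2 * ((c1 / e)\<^sup>2 + ((c2 - k * (c1 / e)) / g)\<^sup>2) / (4 * e * g)
      = unit_ball_vol 2 * (H * c1\<^sup>2 - 2 * F * c1 * c2 + E * c2\<^sup>2) / (4 * (e * g) ^ 3)"
    using pos unfolding e2 F H by (simp add: field_simps power2_eq_square power3_eq_cube)
  ultimately show ?thesis
    using pos by (simp add: measure_elliptic_disc_triangular rD)
qed

section \<open>Directional derivatives\<close>

lemma dir_deriv_eqI:
  assumes "(g has_derivative g') (at p)"
  shows "dir_deriv u g p = g' u"
proof -
  interpret bounded_linear g' using assms by (rule has_derivative_bounded_linear)
  have "((\<lambda>t. p + t *\<^sub>R u) has_derivative (\<lambda>t. t *\<^sub>R u)) (at 0)"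
    by (auto intro!: derivative_eq_intros)
  then have "((\<lambda>t. g (p + t *\<^sub>R u)) has_derivative (\<lambda>t. g' (t *\<^sub>R u))) (at 0)"
    using has_derivative_compose assms by force
  then have "((\<lambda>t. g (p + t *\<^sub>R u)) has_vector_derivative g' u) (at 0)"
    by (simp add: has_vector_derivative_def scaleR)
  then show ?thesis
    unfolding dir_deriv_def by (rule vector_derivative_at)
qed

lemma dir_deriv_cong_open:
  assumes "open S" "p \<in> S" "\<And>x. x \<in> S \<Longrightarrow> f x = g x"
  shows "dir_deriv u f p = dir_deriv u g p"
proof -
  have "((\<lambda>t. p + t *\<^sub>R u) \<longlongrightarrow> p) (nhds 0)"
    by (rule tendsto_eq_intros filterlim_ident | simp)+
  then have "\<forall>\<^sub>F t in nhds 0. p + t *\<^sub>R u \<in> S"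
    using assms(1,2) by (rule topological_tendstoD)
  then have "\<forall>\<^sub>F t in nhds 0. t \<in> UNIV \<longrightarrow> f (p + t *\<^sub>R u) = g (p + t *\<^sub>R u)"
    by eventually_elim (use assms in auto)
  then show ?thesis
    unfolding dir_deriv_def by (rule vector_derivative_cong_eq) auto
qed

section \<open>The anisotropic integrand and its first two derivatives\<close>

text \<open>For a unit vector \<open>w\<close> this is, up to a constant, the area density of the metric \<open>\<bar>y\<bar>\<^sup>2 / (w \<bullet> y)\<close>
  on the plane with normal vector \<open>n\<close>. It is positively homogeneous of degree one in \<open>n\<close>.\<close>

definition kropina_integrand :: "real^3 \<Rightarrow> real^3 \<Rightarrow> real" where
  "kropina_integrand w n = norm n ^ 3 / ((norm n)\<^sup>2 - (w \<bullet> n)\<^sup>2)"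

text \<open>The differential at \<open>n\<close> in the direction \<open>h\<close>, and the Hessian at \<open>n\<close> in the directions \<open>k\<close>
  and \<open>h\<close>. Both are written in the scalars \<open>R = \<bar>n\<bar>\<close> and \<open>a = w \<bullet> n\<close>, of which the integrand is
  a rational function. If \<open>A\<close> and \<open>B\<close> are the coefficients of \<open>n \<bullet> h\<close> and \<open>w \<bullet> h\<close> in the differential, the
  coefficients of the Hessian are \<open>A\<^sub>R / R\<close>, \<open>A\<^sub>a = B\<^sub>R / R\<close>, \<open>A\<close> and \<open>B\<^sub>a\<close>.\<close>

definition kropina_integrand_deriv :: "real^3 \<Rightarrow> real^3 \<Rightarrow> real^3 \<Rightarrow> real" where
  "kropina_integrand_deriv w n h = (let R = norm n; a = w \<bullet> n; Q = R\<^sup>2 - a\<^sup>2 in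
     (R ^ 3 - 3 * a\<^sup>2 * R) / Q\<^sup>2 * (n \<bullet> h) + 2 * a * R ^ 3 / Q\<^sup>2 * (w \<bullet> h))"

definition kropina_integrand_hess :: "real^3 \<Rightarrow> real^3 \<Rightarrow> real^3 \<Rightarrow> real^3 \<Rightarrow> real" where
  "kropina_integrand_hess w n k h = (let R = norm n; a = w \<bullet> n; Q = R\<^sup>2 - a\<^sup>2 in
     (- (R ^ 4) + 6 * a\<^sup>2 * R\<^sup>2 + 3 * a ^ 4) / (R * Q ^ 3) * (n \<bullet> k) * (n \<bullet> h)
     - (2 * a * R ^ 3 + 6 * a ^ 3 * R) / Q ^ 3 * ((w \<bullet> k) * (n \<bullet> h) + (n \<bullet> k) * (w \<bullet> h))
     + (R ^ 3 - 3 * a\<^sup>2 * R) / Q\<^sup>2 * (k \<bullet> h)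
     + (2 * R ^ 5 + 6 * a\<^sup>2 * R ^ 3) / Q ^ 3 * (w \<bullet> k) * (w \<bullet> h))"

lemma has_derivative_norm_compose:
  fixes N :: "'a::real_normed_vector \<Rightarrow> 'b::real_inner"
  assumes "(N has_derivative N') (at x)" "N x \<noteq> 0"
  shows "((\<lambda>x. norm (N x)) has_derivative (\<lambda>u. N x \<bullet> N' u / norm (N x))) (at x)"
  using has_derivative_compose[OF assms(1) has_derivative_norm[OF assms(2)]]
  by (simp add: sgn_div_norm divide_inverse mult.commute inner_commute)

lemma has_derivative_kropina_integrand:
  assumes N: "(N has_derivative N') (at x)" and Q: "(norm (N x))\<^sup>2 > (w \<bullet> N x)\<^sup>2"
  shows "((\<lambda>x. kropina_integrand w (N x)) has_derivative (\<lambda>u. kropina_integrand_deriv w (N x) (N' u))) (at x)"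
proof -
  have [simp]: "N x \<noteq> 0" using Q by auto
  note [derivative_intros] = has_derivative_norm_compose[OF N]
  show ?thesis
    unfolding kropina_integrand_def kropina_integrand_deriv_def Let_def using Q
    apply -
    apply (rule has_derivative_eq_rhs)
     apply (rule derivative_intros N | simp)+
    apply (rule ext)
    apply (simp add: divide_simps power2_eq_square)
    apply (simp add: algebra_simps power2_eq_square eval_nat_numeral)
    done
qed

text \<open>The direction \<open>H x\<close> is allowed to vary with \<open>x\<close>: the differential is later taken in the direction
  of the first variation of the normal vector, which itself depends on the tangent map.\<close>

lemma has_derivative_kropina_integrand_deriv:
  assumes N: "(N has_derivative N') (at x)" and H: "(H has_derivative H') (at x)"
    and Q: "(norm (N x))\<^sup>2 > (w \<bullet> N x)\<^sup>2"
  shows "((\<lambda>x. kropina_integrand_deriv w (N x) (H x)) has_derivative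
           (\<lambda>u. kropina_integrand_hess w (N x) (N' u) (H x) + kropina_integrand_deriv w (N x) (H' u))) (at x)"
proof -
  have [simp]: "N x \<noteq> 0" using Q by auto
  note [derivative_intros] = has_derivative_norm_compose[OF N]
  show ?thesis
    unfolding kropina_integrand_hess_def kropina_integrand_deriv_def Let_def using Q
    apply -
    apply (rule has_derivative_eq_rhs)
     apply (rule derivative_intros N H | simp)+
    apply (rule ext)
    apply (simp add: divide_simps power2_eq_square inner_add)
    apply (simp add: algebra_simps power2_eq_square eval_nat_numeral)
    done
qed

section \<open>The area density of the Kropina metric\<close>

unbundle cross3_syntax

abbreviation normal :: "real^2^3 \<Rightarrow> real^3" where
  "normal z \<equiv> column 1 z \<times> column 2 z"

text \<open>For a unit vector \<open>w\<close>, these are the tangent maps of rank two whose image plane is not orthogonal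
  to \<open>w\<close>: by Lagrange's identity, \<open>\<bar>w \<times> n\<bar>\<^sup>2 = \<bar>n\<bar>\<^sup>2 - (w \<bullet> n)\<^sup>2\<close>.\<close>

definition transversal :: "real^3 \<Rightarrow> (real^2^3) set" where
  "transversal w = {z. (w \<bullet> normal z)\<^sup>2 < (norm (normal z))\<^sup>2}"

lemma linear_column: "linear (column i :: real^'m^'n \<Rightarrow> real^'n)"
  by (rule linearI) (simp_all add: column_def vec_eq_iff)

lemmas bounded_linear_column = linear_column[unfolded linear_conv_bounded_linear]
lemmas bounded_bilinear_cross = bilinear_cross[unfolded bilinear_conv_bounded_bilinear]
lemmas has_derivative_column = bounded_linear.has_derivative[OF bounded_linear_column]
lemmas has_derivative_cross = bounded_bilinear.FDERIV[OF bounded_bilinear_cross]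

lemma open_transversal: "open (transversal w)"
  unfolding transversal_def
  by (intro open_Collect_less continuous_intros continuous_on_cross
      bounded_linear.continuous_on[OF bounded_linear_column])

lemma matrix_vector_mult_column2:
  fixes z :: "real^2^3"
  shows "z *v y = y$1 *\<^sub>R column 1 z + y$2 *\<^sub>R column 2 z"
  by (simp add: matrix_mult_sum sum_2 scalar_mult_eq_scaleR)

lemma lagrange_cross:
  "(norm (x \<times> y))\<^sup>2 = (x \<bullet> x) * (y \<bullet> y) - (x \<bullet> y)\<^sup>2"
  using norm_cross_dot[of x y] by (simp add: power_mult_distrib power2_norm_eq_inner)

text \<open>Both sides are the squared length of \<open>w \<times> (x \<times> y) = (w \<bullet> y) x - (w \<bullet> x) y\<close>. The left-hand side is
  what the area of the elliptic disc produces; the right-hand side depends on \<open>x \<times> y\<close> only.\<close>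

lemma gram_dual_form:
  fixes w x y :: "real^3"
  shows "(y \<bullet> y) * (w \<bullet> x)\<^sup>2 - 2 * (x \<bullet> y) * (w \<bullet> x) * (w \<bullet> y) + (x \<bullet> x) * (w \<bullet> y)\<^sup>2
    = (w \<bullet> w) * (norm (x \<times> y))\<^sup>2 - (w \<bullet> (x \<times> y))\<^sup>2"
  unfolding power2_norm_eq_inner
  by (simp add: cross3_simps power2_eq_square)

lemma transversal_imp_normal_nonzero: "z \<in> transversal w \<Longrightarrow> normal z \<noteq> 0"
  by (auto simp: transversal_def)

lemma transversal_imp_not_annihilated:
  assumes "z \<in> transversal w" "norm w = 1"
  shows "w \<bullet> column 1 z \<noteq> 0 \<or> w \<bullet> column 2 z \<noteq> 0"
proof (rule ccontr)
  assume "\<not> ?thesis"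
  then have "(w \<bullet> w) * (norm (normal z))\<^sup>2 - (w \<bullet> normal z)\<^sup>2 = 0"
    using gram_dual_form[of "column 2 z" w "column 1 z"] by simp
  then show False
    using assms by (simp add: transversal_def dot_square_norm)
qed

definition beta_dir :: "real \<Rightarrow> real^3" where
  "beta_dir \<theta> = vector [cos \<theta>, sin \<theta>, 0]"

lemma norm_beta_dir: "norm (beta_dir \<theta>) = 1"
  by (simp add: beta_dir_def norm_vec_def L2_set_def sum_3)

abbreviation "kropina_metric b \<theta> \<equiv> kropina hyp_alpha (hyp_beta b \<theta>)"
abbreviation "admissible b \<theta> \<equiv> kropina_cone (hyp_beta b \<theta>)"

lemma hyp_beta_eq: "hyp_beta b \<theta> p y = b * (beta_dir \<theta> \<bullet> y) / (p $ 3)\<^sup>2"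
  by (simp add: hyp_beta_def beta_dir_def inner_vec_def sum_3)

lemma admissible_iff: "p $ 3 > 0 \<Longrightarrow> y \<in> admissible b \<theta> p \<longleftrightarrow> b * (beta_dir \<theta> \<bullet> y) > 0"
  by (simp add: kropina_cone_def hyp_beta_eq zero_less_divide_iff)

text \<open>The weights \<open>1 / (p\<^sub>3)\<^sup>2\<close> of \<open>\<alpha>\<^sup>2\<close> and of \<open>\<beta>\<close> cancel, so that the metric is
  translation invariant.\<close>

lemma kropina_metric_eq:
  assumes "p $ 3 > 0"
  shows "kropina_metric b \<theta> p y = (norm y)\<^sup>2 / (b * (beta_dir \<theta> \<bullet> y))"
  using assms
  by (simp add: kropina_def hyp_beta_eq hyp_alpha_def norm_vec_def L2_set_def sum_3 power_divide)

lemma induced_disc_eq: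
  assumes "p $ 3 > 0"
  shows "induced_disc (kropina_metric b \<theta>) (admissible b \<theta>) p z
    = {y. (norm (z *v y))\<^sup>2 < b * (beta_dir \<theta> \<bullet> (z *v y))}"
proof -
  have "0 < c \<and> r / c < 1 \<longleftrightarrow> r < c" if "r \<ge> 0" for r c :: real
    using that by (auto simp: divide_less_eq)
  then show ?thesis
    using assms by (simp add: induced_disc_def induced_cone_def admissible_iff kropina_metric_eq)
qed

text \<open>The vector \<open>b\<close> times the pull-back of \<open>w\<close> is an admissible direction.\<close>

lemma induced_cone_nonempty:
  assumes "p $ 3 > 0" "b \<noteq> 0" "z \<in> transversal (beta_dir \<theta>)"
  shows "induced_cone (admissible b \<theta>) p z \<noteq> {}"
proof -
  let ?w = "beta_dir \<theta>"
  let ?y = "vector [b * (?w \<bullet> column 1 z), b * (?w \<bullet> column 2 z)] :: real^2"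
  have "b * (?w \<bullet> (z *v ?y)) = b\<^sup>2 * ((?w \<bullet> column 1 z)\<^sup>2 + (?w \<bullet> column 2 z)\<^sup>2)"
    by (simp add: matrix_vector_mult_column2 inner_add_right power2_eq_square algebra_simps)
  also have "\<dots> > 0"
    using transversal_imp_not_annihilated[OF assms(3) norm_beta_dir] \<open>b \<noteq> 0\<close>
    by (simp add: sum_power2_gt_zero_iff)
  finally show ?thesis
    using assms(1) admissible_iff by (auto simp: induced_cone_def)
qed

text \<open>The unit disc is \<open>\<bar>z y\<bar>\<^sup>2 < b w \<bullet> z y\<close>, an elliptic disc for the Gram matrix of the two columns,
  whose determinant is \<open>\<bar>n\<bar>\<^sup>2\<close>.\<close>

lemma area_density_kropina:
  assumes "p $ 3 > 0" "b \<noteq> 0" "z \<in> transversal (beta_dir \<theta>)"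
  shows "area_density (kropina_metric b \<theta>) (admissible b \<theta>) p z = 4 / b\<^sup>2 * kropina_integrand (beta_dir \<theta>) (normal z)"
proof -
  let ?w = "beta_dir \<theta>" and ?x = "column 1 z" and ?y = "column 2 z"
  let ?E = "?x \<bullet> ?x" and ?F = "?x \<bullet> ?y" and ?H = "?y \<bullet> ?y"
  let ?c1 = "b * (?w \<bullet> ?x)" and ?c2 = "b * (?w \<bullet> ?y)"
  have n: "normal z \<noteq> 0" using assms(3) by (rule transversal_imp_normal_nonzero)
  then have E: "?E > 0" by auto
  have D: "?E * ?H - ?F\<^sup>2 = (norm (normal z))\<^sup>2" by (simp add: lagrange_cross)
  have quad: "?H * ?c1\<^sup>2 - 2 * ?F * ?c1 * ?c2 + ?E * ?c2\<^sup>2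
    = b\<^sup>2 * ((norm (normal z))\<^sup>2 - (?w \<bullet> normal z)\<^sup>2)"
  proof -
    have "?H * ?c1\<^sup>2 - 2 * ?F * ?c1 * ?c2 + ?E * ?c2\<^sup>2
      = b\<^sup>2 * (?H * (?w \<bullet> ?x)\<^sup>2 - 2 * ?F * (?w \<bullet> ?x) * (?w \<bullet> ?y) + ?E * (?w \<bullet> ?y)\<^sup>2)"
      by (simp add: power2_eq_square algebra_simps)
    then show ?thesis
      by (simp only: gram_dual_form) (simp add: dot_square_norm norm_beta_dir)
  qed
  have "(norm (z *v u))\<^sup>2 = ?E * (u$1)\<^sup>2 + 2 * ?F * u$1 * u$2 + ?H * (u$2)\<^sup>2"
    and "b * (?w \<bullet> (z *v u)) = ?c1 * u$1 + ?c2 * u$2" for u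
    unfolding power2_norm_eq_inner
    by (simp_all add: matrix_vector_mult_column2 inner_add inner_commute power2_eq_square algebra_simps)
  then have disc: "induced_disc (kropina_metric b \<theta>) (admissible b \<theta>) p z
     = {u. ?E * (u$1)\<^sup>2 + 2 * ?F * u$1 * u$2 + ?H * (u$2)\<^sup>2 < ?c1 * u$1 + ?c2 * u$2}"
    using induced_disc_eq[OF assms(1)] by simp
  have area: "measure lborel (induced_disc (kropina_metric b \<theta>) (admissible b \<theta>) p z)
    = unit_ball_vol 2 * (b\<^sup>2 * ((norm (normal z))\<^sup>2 - (?w \<bullet> normal z)\<^sup>2)) / (4 * norm (normal z) ^ 3)"
    unfolding disc using n E by (subst measure_elliptic_disc) (simp_all add: D quad)
  have "unit_ball_vol 2 \<noteq> 0"
    using unit_ball_vol_pos[of 2] by linarith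
  then show ?thesis
    unfolding area_density_def area by (simp add: content_ball kropina_integrand_def)
qed

section \<open>Second variation and mean curvature\<close>

text \<open>The coordinate direction of the matrix entry \<open>(i, \<epsilon>)\<close> is \<open>colmat \<epsilon> (axis i 1)\<close>. By bilinearity, the sums
  over \<open>i\<close> and \<open>j\<close> in the mean curvature contract to evaluations on matrices with one nonzero column.\<close>

definition colmat :: "2 \<Rightarrow> real^3 \<Rightarrow> real^2^3" where
  "colmat \<epsilon> h = (\<chi> i \<eta>. if \<eta> = \<epsilon> then h $ i else 0)"

lemma linear_colmat: "linear (colmat \<epsilon>)"
  by (rule linearI) (simp_all add: colmat_def vec_eq_iff)

lemma colmat_axis: "axis i (axis \<epsilon> 1) = colmat \<epsilon> (axis i 1)"
  by (simp add: colmat_def vec_eq_iff axis_def)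

lemma column_colmat: "column \<eta> (colmat \<epsilon> h) = (if \<eta> = \<epsilon> then h else 0)"
  by (simp add: colmat_def column_def vec_eq_iff)

text \<open>The first variation of the normal vector at \<open>z\<close> in the direction \<open>X\<close>. As the normal vector is
  quadratic in \<open>z\<close>, the same symmetric bilinear map with \<open>z\<close> replaced by \<open>Y\<close> is its second variation.\<close>

definition dnormal :: "real^2^3 \<Rightarrow> real^2^3 \<Rightarrow> real^3" where
  "dnormal z X = column 1 z \<times> column 2 X + column 1 X \<times> column 2 z"

text \<open>The second derivative of \<open>z \<mapsto> \<Phi>(n(z))\<close> by the chain rule, where \<open>\<Phi>\<close> is the integrand.\<close>

definition d2density :: "real^3 \<Rightarrow> real^2^3 \<Rightarrow> real^2^3 \<Rightarrow> real^2^3 \<Rightarrow> real" where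
  "d2density w z X Y = kropina_integrand_hess w (normal z) (dnormal z X) (dnormal z Y)
     + kropina_integrand_deriv w (normal z) (dnormal X Y)"

lemma has_derivative_normal: "(normal has_derivative dnormal z) (at z)"
  unfolding dnormal_def
  by (rule has_derivative_cross has_derivative_column has_derivative_ident)+

lemma has_derivative_dnormal: "((\<lambda>z. dnormal z Y) has_derivative (\<lambda>X. dnormal X Y)) (at z)"
  unfolding dnormal_def
  by (rule has_derivative_eq_rhs,
      (rule has_derivative_add has_derivative_cross has_derivative_column has_derivative_ident has_derivative_const)+)
     simp

lemma linear_kropina_integrand_deriv: "linear (kropina_integrand_deriv w n)"
proof -
  have "linear (\<lambda>h. A * (n \<bullet> h) + B * (w \<bullet> h))" for A B
    unfolding linear_iff by (simp add: inner_add_right algebra_simps)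
  then show ?thesis
    unfolding kropina_integrand_deriv_def Let_def .
qed

lemma bilinear_kropina_integrand_hess: "bilinear (kropina_integrand_hess w n)"
proof -
  have "bilinear (\<lambda>k h. A * (n \<bullet> k) * (n \<bullet> h) - B * ((w \<bullet> k) * (n \<bullet> h) + (n \<bullet> k) * (w \<bullet> h))
      + C * (k \<bullet> h) + D * (w \<bullet> k) * (w \<bullet> h))" for A B C D
    unfolding bilinear_def linear_iff by (simp add: inner_add algebra_simps)
  then show ?thesis
    unfolding kropina_integrand_hess_def Let_def .
qed

lemma bilinear_dnormal: "bilinear dnormal"
  unfolding bilinear_def linear_iff
  by (simp add: dnormal_def cross_add_left cross_add_right cross_mult_left cross_mult_right
      linear_add[OF linear_column] linear_cmul[OF linear_column] scaleR_add_right)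

lemma bilinear_d2density: "bilinear (d2density w z)"
  using bilinear_dnormal bilinear_kropina_integrand_hess[of w "normal z"] linear_kropina_integrand_deriv[of w "normal z"]
  unfolding d2density_def bilinear_def linear_iff by (simp add: distrib_left)

lemma mpartial2_density:
  assumes "p $ 3 > 0" "b \<noteq> 0" "z \<in> transversal (beta_dir \<theta>)"
  shows "dir_deriv X (dir_deriv Y (area_density (kropina_metric b \<theta>) (admissible b \<theta>) p)) z
    = 4 / b\<^sup>2 * d2density (beta_dir \<theta>) z X Y"
proof -
  let ?w = "beta_dir \<theta>" and ?U = "transversal (beta_dir \<theta>)"
  have U: "(?w \<bullet> normal z)\<^sup>2 < (norm (normal z))\<^sup>2" if "z \<in> ?U" for z
    using that by (simp add: transversal_def)
  have first: "dir_deriv Y (area_density (kropina_metric b \<theta>) (admissible b \<theta>) p) z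
    = 4 / b\<^sup>2 * kropina_integrand_deriv ?w (normal z) (dnormal z Y)" if z: "z \<in> ?U" for z
  proof -
    have "dir_deriv Y (area_density (kropina_metric b \<theta>) (admissible b \<theta>) p) z
      = dir_deriv Y (\<lambda>z. 4 / b\<^sup>2 * kropina_integrand ?w (normal z)) z"
      using open_transversal z by (rule dir_deriv_cong_open) (simp add: area_density_kropina assms)
    also have "\<dots> = 4 / b\<^sup>2 * kropina_integrand_deriv ?w (normal z) (dnormal z Y)"
      by (rule dir_deriv_eqI has_derivative_mult_right has_derivative_kropina_integrand has_derivative_normal U z)+
    finally show ?thesis .
  qed
  have "dir_deriv X (dir_deriv Y (area_density (kropina_metric b \<theta>) (admissible b \<theta>) p)) z
      = dir_deriv X (\<lambda>z. 4 / b\<^sup>2 * kropina_integrand_deriv ?w (normal z) (dnormal z Y)) z"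
    using open_transversal assms(3) by (rule dir_deriv_cong_open) (rule first)
  also have "\<dots> = 4 / b\<^sup>2 * d2density ?w z X Y"
    unfolding d2density_def
    by (rule dir_deriv_eqI has_derivative_mult_right has_derivative_kropina_integrand_deriv has_derivative_normal
        has_derivative_dnormal U assms(3))+
  finally show ?thesis .
qed

lemma partial_area_density_base_point:
  assumes "p $ 3 > 0"
  shows "dir_deriv u (\<lambda>p. area_density (kropina_metric b \<theta>) (admissible b \<theta>) p z) p = 0"
proof -
  have open3: "open {p::real^3. p $ 3 > 0}" by (intro open_Collect_less continuous_intros)
  have "dir_deriv u (\<lambda>p. area_density (kropina_metric b \<theta>) (admissible b \<theta>) p z) p
    = dir_deriv u (\<lambda>_. area_density (kropina_metric b \<theta>) (admissible b \<theta>) p z) p"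
    by (rule dir_deriv_cong_open[OF open3])
      (use assms in \<open>auto simp: area_density_def induced_disc_eq\<close>)
  also have "\<dots> = 0"
    by (rule dir_deriv_eqI has_derivative_const)+
  finally show ?thesis .
qed

lemma bilinear_sum_axis:
  fixes v :: "real^'n" and y :: "real^'m" and B :: "real^'n \<Rightarrow> real^'m \<Rightarrow> real"
  assumes "bilinear B"
  shows "(\<Sum>i\<in>UNIV. \<Sum>j\<in>UNIV. B (axis i 1) (axis j 1) * y $ j * v $ i) = B v y"
proof -
  interpret b: bounded_bilinear B using assms bilinear_conv_bounded_bilinear by blast
  have "B v y = B (\<Sum>i\<in>UNIV. v $ i *\<^sub>R axis i 1) (\<Sum>j\<in>UNIV. y $ j *\<^sub>R axis j 1)"
    by (simp add: basis_expansion flip: scalar_mult_eq_scaleR)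
  also have "\<dots> = (\<Sum>j\<in>UNIV. \<Sum>i\<in>UNIV. B (axis i 1) (axis j 1) * y $ j * v $ i)"
    by (simp add: b.sum_left b.sum_right b.scaleR_left b.scaleR_right ac_simps sum_distrib_left)
  finally show ?thesis
    by (subst sum.swap) simp
qed

text \<open>The constant \<open>4 / b\<^sup>2\<close> cancels against the normalisation by the area density, and the terms with
  derivatives in the base point vanish because the metric is translation invariant.\<close>

lemma mean_curvature_kropina:
  fixes \<phi> :: "real^2 \<Rightarrow> real^3"
  defines "\<phi>2 \<equiv> \<lambda>\<epsilon> \<eta> x. (\<chi> j. partial \<epsilon> (partial \<eta> (\<lambda>x'. \<phi> x' $ j)) x)"
  assumes "\<phi> x $ 3 > 0" "b \<noteq> 0" and z: "jacobian_matrix \<phi> x \<in> transversal (beta_dir \<theta>)"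
  shows "mean_curvature (kropina_metric b \<theta>) (admissible b \<theta>) \<phi> v x =
    (\<Sum>\<epsilon>\<in>UNIV. \<Sum>\<eta>\<in>UNIV. d2density (beta_dir \<theta>) (jacobian_matrix \<phi> x)
        (colmat \<epsilon> (v (\<phi> x))) (colmat \<eta> (\<phi>2 \<epsilon> \<eta> x)))
    / kropina_integrand (beta_dir \<theta>) (normal (jacobian_matrix \<phi> x))"
proof -
  let ?z = "jacobian_matrix \<phi> x"
  let ?B = "d2density (beta_dir \<theta>) ?z"
  let ?F = "area_density (kropina_metric b \<theta>) (admissible b \<theta>)"
  have zero: "partial j (\<lambda>p. ?F p z') (\<phi> x) = 0" for j z'
    using assms by (intro partial_area_density_base_point)
  have zero': "mpartial i \<epsilon> (\<lambda>z'. 0::real) ?z = 0" for i \<epsilon>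
    by (rule dir_deriv_eqI has_derivative_const)+
  have bil: "bilinear (\<lambda>h k. ?B (colmat \<epsilon> h) (colmat \<eta> k))" for \<epsilon> \<eta>
    using bilinear_d2density[of "beta_dir \<theta>" ?z] linear_colmat
    unfolding bilinear_def linear_iff by simp
  have "(\<Sum>i\<in>UNIV. ((\<Sum>\<epsilon>\<in>UNIV. \<Sum>\<eta>\<in>UNIV. \<Sum>j\<in>UNIV.
             mpartial i \<epsilon> (mpartial j \<eta> (?F (\<phi> x))) ?z * \<phi>2 \<epsilon> \<eta> x $ j)) * v (\<phi> x) $ i)
    = 4 / b\<^sup>2 * (\<Sum>i\<in>UNIV. \<Sum>\<epsilon>\<in>UNIV. \<Sum>\<eta>\<in>UNIV. \<Sum>j\<in>UNIV.
        ?B (colmat \<epsilon> (axis i 1)) (colmat \<eta> (axis j 1)) * \<phi>2 \<epsilon> \<eta> x $ j * v (\<phi> x) $ i)"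
    using assms
    by (simp add: mpartial2_density colmat_axis sum_distrib_left sum_distrib_right sum_divide_distrib ac_simps)
  also have "(\<Sum>i\<in>UNIV. \<Sum>\<epsilon>\<in>UNIV. \<Sum>\<eta>\<in>UNIV. \<Sum>j\<in>UNIV.
        ?B (colmat \<epsilon> (axis i 1)) (colmat \<eta> (axis j 1)) * \<phi>2 \<epsilon> \<eta> x $ j * v (\<phi> x) $ i)
    = (\<Sum>\<epsilon>\<in>UNIV. \<Sum>\<eta>\<in>UNIV. \<Sum>i\<in>UNIV. \<Sum>j\<in>UNIV.
        ?B (colmat \<epsilon> (axis i 1)) (colmat \<eta> (axis j 1)) * \<phi>2 \<epsilon> \<eta> x $ j * v (\<phi> x) $ i)"
    by (subst sum.swap, rule sum.cong[OF refl], subst sum.swap, rule refl)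
  also have "\<dots> = (\<Sum>\<epsilon>\<in>UNIV. \<Sum>\<eta>\<in>UNIV. ?B (colmat \<epsilon> (v (\<phi> x))) (colmat \<eta> (\<phi>2 \<epsilon> \<eta> x)))"
    by (simp only: bilinear_sum_axis[OF bil])
  finally show ?thesis
    using assms
    by (simp add: mean_curvature_def Let_def zero zero' \<phi>2_def area_density_kropina)
qed

section \<open>The moving frame of a surface of rotation\<close>

text \<open>All coordinate functions of a surface of rotation, and all their first partial derivatives, are
  products of a function of \<open>x\<^sub>1\<close> and a function of \<open>x\<^sub>2\<close>.\<close>

lemma partial_separated:
  assumes "(g has_real_derivative g') (at (x$1))" "(c has_real_derivative c') (at (x$2))"
  shows "partial 1 (\<lambda>x::real^2. g (x$1) * c (x$2)) x = g' * c (x$2)"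
    and "partial 2 (\<lambda>x::real^2. g (x$1) * c (x$2)) x = g (x$1) * c'"
proof -
  have nth: "((\<lambda>x::real^2. x$i) has_derivative (\<lambda>h. h$i)) (at x)" for i
    by (rule bounded_linear_imp_has_derivative bounded_linear_vec_nth)+
  have "((\<lambda>x::real^2. g (x$1) * c (x$2)) has_derivative
      (\<lambda>h. g (x$1) * (c' * h$2) + g' * h$1 * c (x$2))) (at x)"
    using has_derivative_mult[OF
        has_derivative_compose[OF nth assms(1)[unfolded has_field_derivative_def]]
        has_derivative_compose[OF nth assms(2)[unfolded has_field_derivative_def]]]
    by simp
  note d = dir_deriv_eqI[OF this]
  show "partial 1 (\<lambda>x::real^2. g (x$1) * c (x$2)) x = g' * c (x$2)"
    and "partial 2 (\<lambda>x::real^2. g (x$1) * c (x$2)) x = g (x$1) * c'"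
    unfolding d by (simp_all add: axis_def)
qed

definition e_radial :: "real \<Rightarrow> real^3" where "e_radial s = vector [cos s, sin s, 0]"
definition e_angular :: "real \<Rightarrow> real^3" where "e_angular s = vector [- sin s, cos s, 0]"
definition e_axial :: "real^3" where "e_axial = vector [0, 0, 1]"

lemmas frame_defs = e_radial_def e_angular_def e_axial_def

lemma vec3_eq_iff: "(x::'a^3) = y \<longleftrightarrow> x $ 1 = y $ 1 \<and> x $ 2 = y $ 2 \<and> x $ 3 = y $ 3"
  by (simp add: vec_eq_iff forall_3)

lemma frame_cross:
  "e_radial s \<times> e_angular s = e_axial"
  "e_axial \<times> e_radial s = e_angular s"
  "e_axial \<times> e_angular s = - e_radial s"
  by (simp_all add: frame_defs vec3_eq_iff cross_components flip: power2_eq_square)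

lemma frame_inner:
  "e_radial s \<bullet> e_radial s = 1" "e_radial s \<bullet> e_angular s = 0" "e_radial s \<bullet> e_axial = 0"
  "e_angular s \<bullet> e_angular s = 1" "e_angular s \<bullet> e_axial = 0" "e_axial \<bullet> e_axial = 1"
  "e_angular s \<bullet> e_radial s = 0" "e_axial \<bullet> e_radial s = 0" "e_axial \<bullet> e_angular s = 0"
  by (simp_all add: frame_defs inner_vec_def sum_3 flip: power2_eq_square)

lemma beta_dir_frame:
  "beta_dir \<theta> \<bullet> e_radial s = cos (s - \<theta>)"
  "beta_dir \<theta> \<bullet> e_angular s = - sin (s - \<theta>)"
  "beta_dir \<theta> \<bullet> e_axial = 0"
  by (simp_all add: frame_defs beta_dir_def inner_vec_def sum_3 cos_diff sin_diff)

context
  fixes f f1 f2 :: "real \<Rightarrow> real"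
  assumes Df: "\<forall>t>0. (f has_real_derivative f1 t) (at t)"
    and Df1: "\<forall>t>0. (f1 has_real_derivative f2 t) (at t)"
begin

lemma rotation_surface_partials:
  assumes "x $ 1 > 0"
  shows "partial 1 (\<lambda>x. rotation_surface f x $ j) x = (f1 (x$1) *\<^sub>R e_radial (x$2) + e_axial) $ j"
    and "partial 2 (\<lambda>x. rotation_surface f x $ j) x = (f (x$1) *\<^sub>R e_angular (x$2)) $ j"
proof -
  note D = Df[rule_format, OF assms]
  have comp: "(\<lambda>x. rotation_surface f x $ 1) = (\<lambda>x. f (x$1) * cos (x$2))"
    "(\<lambda>x. rotation_surface f x $ 2) = (\<lambda>x. f (x$1) * sin (x$2))"
    "(\<lambda>x. rotation_surface f x $ 3) = (\<lambda>x. x$1 * 1)"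
    by (simp_all add: rotation_surface_def fun_eq_iff)
  note P = partial_separated[OF D DERIV_cos] partial_separated[OF D DERIV_sin]
    partial_separated[OF DERIV_ident DERIV_const]
  have "\<forall>j. partial 1 (\<lambda>x. rotation_surface f x $ j) x = (f1 (x$1) *\<^sub>R e_radial (x$2) + e_axial) $ j"
    unfolding forall_3 comp P by (simp add: frame_defs)
  moreover have "\<forall>j. partial 2 (\<lambda>x. rotation_surface f x $ j) x = (f (x$1) *\<^sub>R e_angular (x$2)) $ j"
    unfolding forall_3 comp P by (simp add: frame_defs)
  ultimately show "partial 1 (\<lambda>x. rotation_surface f x $ j) x = (f1 (x$1) *\<^sub>R e_radial (x$2) + e_axial) $ j"
    and "partial 2 (\<lambda>x. rotation_surface f x $ j) x = (f (x$1) *\<^sub>R e_angular (x$2)) $ j"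
    by blast+
qed

lemma rotation_surface_second_partials:
  assumes "x $ 1 > 0"
  shows "(\<chi> j. partial 1 (partial 1 (\<lambda>x. rotation_surface f x $ j)) x) = f2 (x$1) *\<^sub>R e_radial (x$2)"
    and "(\<chi> j. partial 1 (partial 2 (\<lambda>x. rotation_surface f x $ j)) x) = f1 (x$1) *\<^sub>R e_angular (x$2)"
    and "(\<chi> j. partial 2 (partial 1 (\<lambda>x. rotation_surface f x $ j)) x) = f1 (x$1) *\<^sub>R e_angular (x$2)"
    and "(\<chi> j. partial 2 (partial 2 (\<lambda>x. rotation_surface f x $ j)) x) = - f (x$1) *\<^sub>R e_radial (x$2)"
proof -
  have op: "open {x::real^2. x $ 1 > 0}" by (intro open_Collect_less continuous_intros)
  have first: "partial \<epsilon> (partial 1 (\<lambda>x. rotation_surface f x $ j)) x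
      = partial \<epsilon> (\<lambda>x. (f1 (x$1) *\<^sub>R e_radial (x$2) + e_axial) $ j) x"
    "partial \<epsilon> (partial 2 (\<lambda>x. rotation_surface f x $ j)) x
      = partial \<epsilon> (\<lambda>x. (f (x$1) *\<^sub>R e_angular (x$2)) $ j) x" for \<epsilon> j
    by (rule dir_deriv_cong_open[OF op]; use assms rotation_surface_partials in simp)+
  have comp1: "(\<lambda>x::real^2. (f1 (x$1) *\<^sub>R e_radial (x$2) + e_axial) $ 1) = (\<lambda>x. f1 (x$1) * cos (x$2))"
    "(\<lambda>x::real^2. (f1 (x$1) *\<^sub>R e_radial (x$2) + e_axial) $ 2) = (\<lambda>x. f1 (x$1) * sin (x$2))"
    "(\<lambda>x::real^2. (f1 (x$1) *\<^sub>R e_radial (x$2) + e_axial) $ 3) = (\<lambda>x. 1 * 1)"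
    by (simp_all add: frame_defs fun_eq_iff)
  have comp2: "(\<lambda>x::real^2. (f (x$1) *\<^sub>R e_angular (x$2)) $ 1) = (\<lambda>x. f (x$1) * - sin (x$2))"
    "(\<lambda>x::real^2. (f (x$1) *\<^sub>R e_angular (x$2)) $ 2) = (\<lambda>x. f (x$1) * cos (x$2))"
    "(\<lambda>x::real^2. (f (x$1) *\<^sub>R e_angular (x$2)) $ 3) = (\<lambda>x. 0 * 1)"
    by (simp_all add: frame_defs fun_eq_iff)
  note D = Df[rule_format, OF assms] and D1 = Df1[rule_format, OF assms]
  note P = partial_separated[OF D1 DERIV_cos] partial_separated[OF D1 DERIV_sin]
    partial_separated[OF D DERIV_minus[OF DERIV_sin]] partial_separated[OF D DERIV_cos]
    partial_separated[OF DERIV_const DERIV_const]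
  show "(\<chi> j. partial 1 (partial 1 (\<lambda>x. rotation_surface f x $ j)) x) = f2 (x$1) *\<^sub>R e_radial (x$2)"
    and "(\<chi> j. partial 1 (partial 2 (\<lambda>x. rotation_surface f x $ j)) x) = f1 (x$1) *\<^sub>R e_angular (x$2)"
    and "(\<chi> j. partial 2 (partial 1 (\<lambda>x. rotation_surface f x $ j)) x) = f1 (x$1) *\<^sub>R e_angular (x$2)"
    and "(\<chi> j. partial 2 (partial 2 (\<lambda>x. rotation_surface f x $ j)) x) = - f (x$1) *\<^sub>R e_radial (x$2)"
    unfolding vec3_eq_iff vec_lambda_beta first comp1 comp2 P by (simp_all add: frame_defs)
qed

lemma rotation_surface_columns:
  assumes "x $ 1 > 0"
  shows "column 1 (jacobian_matrix (rotation_surface f) x) = f1 (x$1) *\<^sub>R e_radial (x$2) + e_axial"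
    and "column 2 (jacobian_matrix (rotation_surface f) x) = f (x$1) *\<^sub>R e_angular (x$2)"
  using rotation_surface_partials[OF assms] by (simp_all add: column_def jacobian_matrix_def vec_eq_iff)

end

section \<open>The minimality equation of a surface of rotation\<close>

text \<open>Euler's relation: the differential is homogeneous of degree zero in \<open>n\<close>, hence constant along rays.\<close>

lemma kropina_integrand_hess_radial:
  assumes "(w \<bullet> n)\<^sup>2 < (norm n)\<^sup>2"
  shows "kropina_integrand_hess w n k n = 0"
proof -
  define R a Q where "R = norm n" and "a = w \<bullet> n" and "Q = R\<^sup>2 - a\<^sup>2"
  have "Q \<noteq> 0" "R \<noteq> 0" using assms by (auto simp: Q_def R_def a_def)
  have nn: "n \<bullet> n = R\<^sup>2" by (simp add: R_def power2_norm_eq_inner)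
  have collect: "A * p * s - B * (v * s + p * a) + C * p + D * v * a
      = (A * s - B * a + C) * p + (D * a - B * s) * v" for A B C D p s v :: real
    by (simp add: algebra_simps)
  have "kropina_integrand_hess w n k n =
     ((- (R ^ 4) + 6 * a\<^sup>2 * R\<^sup>2 + 3 * a ^ 4) / (R * Q ^ 3) * R\<^sup>2
       - (2 * a * R ^ 3 + 6 * a ^ 3 * R) / Q ^ 3 * a + (R ^ 3 - 3 * a\<^sup>2 * R) / Q\<^sup>2) * (n \<bullet> k)
     + ((2 * R ^ 5 + 6 * a\<^sup>2 * R ^ 3) / Q ^ 3 * a - (2 * a * R ^ 3 + 6 * a ^ 3 * R) / Q ^ 3 * R\<^sup>2) * (w \<bullet> k)"
    unfolding kropina_integrand_hess_def Let_def R_def[symmetric] a_def[symmetric] Q_def[symmetric] nn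
      inner_commute[of k n] collect ..
  also have "(- (R ^ 4) + 6 * a\<^sup>2 * R\<^sup>2 + 3 * a ^ 4) / (R * Q ^ 3) * R\<^sup>2
       - (2 * a * R ^ 3 + 6 * a ^ 3 * R) / Q ^ 3 * a + (R ^ 3 - 3 * a\<^sup>2 * R) / Q\<^sup>2 = 0"
  proof -
    have common: "X / (R * Q ^ 3) * R\<^sup>2 - Y / Q ^ 3 * a + Z / Q\<^sup>2 = (X * R - Y * a + Z * Q) / Q ^ 3"
      for X Y Z
      using \<open>Q \<noteq> 0\<close> \<open>R \<noteq> 0\<close> by (simp add: field_simps power2_eq_square power3_eq_cube)
    show ?thesis
      unfolding common by (simp add: Q_def algebra_simps eval_nat_numeral)
  qed
  also have "(2 * R ^ 5 + 6 * a\<^sup>2 * R ^ 3) / Q ^ 3 * a - (2 * a * R ^ 3 + 6 * a ^ 3 * R) / Q ^ 3 * R\<^sup>2 = 0"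
    by (simp add: algebra_simps eval_nat_numeral)
  finally show ?thesis by simp
qed

text \<open>The left-hand side of the minimality equation of a surface of rotation with profile \<open>f\<close>, cleared of
  denominators, where \<open>\<rho> = 1 + f'\<^sup>2\<close>, \<open>\<kappa> = f f''\<close> and \<open>C = cos\<^sup>2 (x\<^sub>2 - \<theta>)\<close>.\<close>

definition rotation_residual :: "real \<Rightarrow> real \<Rightarrow> real \<Rightarrow> real" where
  "rotation_residual \<rho> \<kappa> C =
     \<kappa> * ((\<rho> - 3 * C) * (\<rho> - C) + 2 * (\<rho> + 3 * C) * (\<rho> - 1) * C)
     - \<rho> * ((\<rho> - 3 * C) * (\<rho> - C) + 2 * \<rho> * (\<rho> + 3 * C) * (1 - C))"

text \<open>The variation is taken in the radial direction, which is never tangent to the surface. Along it, three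
  simplifications leave only the Hessian of the integrand on the axial and on the angular direction: the second
  variations of the normal vector that come from the two mixed partial derivatives are opposite; the term with
  the mixed derivative in the first column does not change the normal vector to first order; and the other mixed derivative
  changes the normal vector by a multiple of itself, which the Hessian annihilates.\<close>

lemma euler_lagrange_rotation:
  fixes f f1 f2 s \<theta> :: real
  defines "z1 \<equiv> f1 *\<^sub>R e_radial s + e_axial" and "z2 \<equiv> f *\<^sub>R e_angular s"
    and "\<rho> \<equiv> 1 + f1\<^sup>2" and "C \<equiv> (cos (s - \<theta>))\<^sup>2"
  assumes f: "f > 0" and z: "column 1 z = z1" "column 2 z = z2" and C: "C < \<rho>"
  shows "z \<in> transversal (beta_dir \<theta>)"
    and "d2density (beta_dir \<theta>) z (colmat 1 (e_radial s)) (colmat 1 (f2 *\<^sub>R e_radial s))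
       + d2density (beta_dir \<theta>) z (colmat 1 (e_radial s)) (colmat 2 (f1 *\<^sub>R e_angular s))
       + (d2density (beta_dir \<theta>) z (colmat 2 (e_radial s)) (colmat 1 (f1 *\<^sub>R e_angular s))
       + d2density (beta_dir \<theta>) z (colmat 2 (e_radial s)) (colmat 2 (- f *\<^sub>R e_radial s)))
       = rotation_residual \<rho> (f * f2) C / (sqrt \<rho> * (\<rho> - C) ^ 3)"
proof -
  let ?w = "beta_dir \<theta>" and ?er = "e_radial s" and ?es = "e_angular s" and ?e3 = e_axial
  define n where "n = (f * f1) *\<^sub>R ?e3 - f *\<^sub>R ?er"
  define r where "r = sqrt \<rho>"
  define c where "c = cos (s - \<theta>)"
  have \<rho>: "\<rho> > 0" by (simp add: \<rho>_def add_pos_nonneg)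
  then have r: "r > 0" "r\<^sup>2 = \<rho>" by (simp_all add: r_def)
  have c: "c\<^sup>2 = C" by (simp add: C_def c_def)
  have sin2: "(sin (s - \<theta>))\<^sup>2 = 1 - C" by (simp add: C_def sin_squared_eq)
  note cross = cross_add_left cross_add_right cross_mult_left cross_mult_right frame_cross
  have n: "normal z = n"
    unfolding z z1_def z2_def n_def by (simp add: cross algebra_simps)
  have n_inner: "n \<bullet> ?e3 = f * f1" "n \<bullet> ?es = 0" "n \<bullet> n = f\<^sup>2 * \<rho>" "?w \<bullet> n = - f * c"
    by (simp_all add: n_def inner_diff_left inner_diff_right frame_inner
        beta_dir_frame \<rho>_def c_def power2_eq_square algebra_simps)
  have norm_n: "norm n = f * r"
    using f by (simp add: norm_eq_sqrt_inner n_inner r_def real_sqrt_mult)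
  have Q: "(norm n)\<^sup>2 - (?w \<bullet> n)\<^sup>2 = f\<^sup>2 * (\<rho> - C)"
    by (simp add: norm_n n_inner power_mult_distrib r c algebra_simps)
  moreover have "f\<^sup>2 * (\<rho> - C) > 0" using f C by simp
  ultimately have lt: "(?w \<bullet> n)\<^sup>2 < (norm n)\<^sup>2" by linarith
  then show "z \<in> transversal ?w" by (simp add: transversal_def n)
  have dn1: "dnormal z (colmat 1 h) = h \<times> z2" and dn2: "dnormal z (colmat 2 h) = z1 \<times> h" for h
    by (simp_all add: dnormal_def column_colmat z)
  have dn: "dnormal z (colmat 1 ?er) = f *\<^sub>R ?e3"
    "dnormal z (colmat 1 (f2 *\<^sub>R ?er)) = (f2 * f) *\<^sub>R ?e3"
    "dnormal z (colmat 1 (f1 *\<^sub>R ?es)) = 0"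
    "dnormal z (colmat 2 ?er) = ?es"
    "dnormal z (colmat 2 (f1 *\<^sub>R ?es)) = (f1 / f) *\<^sub>R n"
    "dnormal z (colmat 2 (- f *\<^sub>R ?er)) = - f *\<^sub>R ?es"
    using f unfolding dn1 dn2 z1_def z2_def n_def
    by (simp_all add: cross algebra_simps)
  have ddn: "dnormal (colmat 1 ?er) (colmat 1 h) = 0" "dnormal (colmat 2 ?er) (colmat 2 h) = 0"
    "dnormal (colmat 1 ?er) (colmat 2 (f1 *\<^sub>R ?es)) = f1 *\<^sub>R ?e3"
    "dnormal (colmat 2 ?er) (colmat 1 (f1 *\<^sub>R ?es)) = - f1 *\<^sub>R ?e3" for h
    by (simp_all add: dnormal_def column_colmat cross cross_skew[of ?es ?er])
  interpret H: bounded_bilinear "kropina_integrand_hess ?w n"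
    using bilinear_kropina_integrand_hess bilinear_conv_bounded_bilinear by blast
  have lin0: "kropina_integrand_deriv ?w n 0 = 0" "kropina_integrand_deriv ?w n (- f1 *\<^sub>R ?e3) = - kropina_integrand_deriv ?w n (f1 *\<^sub>R ?e3)"
    using linear_0[OF linear_kropina_integrand_deriv] linear_neg[OF linear_kropina_integrand_deriv, of ?w n "f1 *\<^sub>R ?e3"] by simp_all
  \<comment> \<open>\<open>X\<close>, \<open>Y\<close> and \<open>Z\<close> are the coefficients of the Hessian after the powers of \<open>f\<close> have been split off.\<close>
  define q where "q = \<rho> - C"
  define X where "X = - (r ^ 4) + 6 * c\<^sup>2 * r\<^sup>2 + 3 * c ^ 4"
  define Y where "Y = r ^ 3 - 3 * c\<^sup>2 * r"
  define Z where "Z = 2 * r ^ 5 + 6 * c\<^sup>2 * r ^ 3"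
  define P1 where "P1 = (\<rho> - 3 * C) * (\<rho> - C) + 2 * (\<rho> + 3 * C) * (\<rho> - 1) * C"
  define P2 where "P2 = (\<rho> - 3 * C) * (\<rho> - C) + 2 * \<rho> * (\<rho> + 3 * C) * (1 - C)"
  have q: "q > 0" using C by (simp add: q_def)
  have f1: "f1\<^sup>2 = r\<^sup>2 - 1" by (simp add: r \<rho>_def)
  have Q: "(norm n)\<^sup>2 - (?w \<bullet> n)\<^sup>2 = f\<^sup>2 * q"
    by (simp add: Q q_def)
  have cancel: "f ^ k * A / (f ^ k * B) = A / B" for k :: nat and A B
    using f by simp
  have X: "(- ((f * r) ^ 4) + 6 * (- f * c)\<^sup>2 * (f * r)\<^sup>2 + 3 * (- f * c) ^ 4) / (f * r * (f\<^sup>2 * q) ^ 3)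
      = X / (f ^ 3 * (r * q ^ 3))"
    by (rule trans[OF arg_cong2[where f="(/)"] cancel[of 4]])
      (simp_all add: X_def algebra_simps eval_nat_numeral)
  have Y: "((f * r) ^ 3 - 3 * (- f * c)\<^sup>2 * (f * r)) / (f\<^sup>2 * q)\<^sup>2 = Y / (f * q\<^sup>2)"
    by (rule trans[OF arg_cong2[where f="(/)"] cancel[of 3]])
      (simp_all add: Y_def algebra_simps eval_nat_numeral)
  have Z: "(2 * (f * r) ^ 5 + 6 * (- f * c)\<^sup>2 * (f * r) ^ 3) / (f\<^sup>2 * q) ^ 3 = Z / (f * q ^ 3)"
    by (rule trans[OF arg_cong2[where f="(/)"] cancel[of 5]])
      (simp_all add: Z_def algebra_simps eval_nat_numeral)
  have "d2density ?w z (colmat 1 ?er) (colmat 1 (f2 *\<^sub>R ?er))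
       + d2density ?w z (colmat 1 ?er) (colmat 2 (f1 *\<^sub>R ?es))
       + (d2density ?w z (colmat 2 ?er) (colmat 1 (f1 *\<^sub>R ?es))
       + d2density ?w z (colmat 2 ?er) (colmat 2 (- f *\<^sub>R ?er)))
     = f * (f2 * f) * kropina_integrand_hess ?w n ?e3 ?e3 - f * kropina_integrand_hess ?w n ?es ?es"
    unfolding d2density_def dn ddn n
    by (simp only: H.scaleR_left H.scaleR_right H.zero_right kropina_integrand_hess_radial[OF lt] lin0) simp
  also have "kropina_integrand_hess ?w n ?e3 ?e3 = P1 / (f * r * q ^ 3)"
  proof -
    have scale: "X / (f ^ 3 * (r * q ^ 3)) * (f * f1) * (f * f1) + Y / (f * q\<^sup>2)
        = (X * f1\<^sup>2 + Y * r * q) / (f * r * q ^ 3)" for X Y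
      using f r(1) q by (simp add: field_simps power2_eq_square power3_eq_cube)
    have "kropina_integrand_hess ?w n ?e3 ?e3 = (X * f1\<^sup>2 + Y * r * q) / (f * r * q ^ 3)"
      unfolding kropina_integrand_hess_def Let_def Q by (simp only: norm_n n_inner beta_dir_frame frame_inner X Y scale[symmetric]) simp
    also have "X * f1\<^sup>2 + Y * r * q = P1"
      unfolding X_def Y_def P1_def q_def r(2)[symmetric] c[symmetric] f1
      by (simp add: algebra_simps eval_nat_numeral)
    finally show ?thesis .
  qed
  also have "kropina_integrand_hess ?w n ?es ?es = r * P2 / (f * q ^ 3)"
  proof -
    have "kropina_integrand_hess ?w n ?es ?es = Y / (f * q\<^sup>2) + Z / (f * q ^ 3) * (sin (s - \<theta>))\<^sup>2"
      unfolding kropina_integrand_hess_def Let_def Q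
      by (simp only: norm_n n_inner beta_dir_frame frame_inner Y Z) (simp add: power2_eq_square)
    also have "\<dots> = (Y * q + Z * (1 - C)) / (f * q ^ 3)"
      unfolding sin2 using f q by (simp add: field_simps power2_eq_square power3_eq_cube)
    also have "Y * q + Z * (1 - C) = r * P2"
      unfolding Y_def Z_def P2_def q_def r(2)[symmetric] c[symmetric]
      by (simp add: algebra_simps eval_nat_numeral)
    finally show ?thesis .
  qed
  also have "f * (f2 * f) * (P1 / (f * r * q ^ 3)) - f * (r * P2 / (f * q ^ 3))
    = (f * f2 * P1 - r\<^sup>2 * P2) / (r * q ^ 3)"
    using f r(1) q by (simp add: field_simps power2_eq_square power3_eq_cube)
  also have "f * f2 * P1 - r\<^sup>2 * P2 = rotation_residual \<rho> (f * f2) C"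
    by (simp add: r rotation_residual_def P1_def P2_def)
  finally show "d2density ?w z (colmat 1 ?er) (colmat 1 (f2 *\<^sub>R ?er))
       + d2density ?w z (colmat 1 ?er) (colmat 2 (f1 *\<^sub>R ?es))
       + (d2density ?w z (colmat 2 ?er) (colmat 1 (f1 *\<^sub>R ?es))
       + d2density ?w z (colmat 2 ?er) (colmat 2 (- f *\<^sub>R ?er)))
       = rotation_residual \<rho> (f * f2) C / (sqrt \<rho> * (\<rho> - C) ^ 3)"
    by (simp only: r_def q_def)
qed

lemma kropina_integrand_pos:
  assumes "(w \<bullet> n)\<^sup>2 < (norm n)\<^sup>2"
  shows "kropina_integrand w n > 0"
proof -
  have "n \<noteq> 0" using assms by auto
  then show ?thesis using assms by (simp add: kropina_integrand_def)
qed

text \<open>The hypothesis on \<open>C\<close> excludes exactly the points at which the tangent plane is orthogonal to \<open>w\<close>,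
  where no metric is induced.\<close>

lemma minimal_imp_residual_zero:
  assumes Df: "\<forall>t>0. (f has_real_derivative f1 t) (at t)"
    and Df1: "\<forall>t>0. (f1 has_real_derivative f2 t) (at t)"
    and min: "minimal (kropina_metric b \<theta>) (admissible b \<theta>) M (rotation_surface f)"
    and x: "x \<in> M" "x $ 1 > 0" and "b \<noteq> 0" and f: "f (x $ 1) > 0"
    and C: "(cos (x $ 2 - \<theta>))\<^sup>2 < 1 + (f1 (x $ 1))\<^sup>2"
  shows "rotation_residual (1 + (f1 (x $ 1))\<^sup>2) (f (x $ 1) * f2 (x $ 1)) ((cos (x $ 2 - \<theta>))\<^sup>2) = 0"
proof -
  let ?z = "jacobian_matrix (rotation_surface f) x" and ?w = "beta_dir \<theta>"
  have p3: "rotation_surface f x $ 3 > 0" using x by (simp add: rotation_surface_def)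
  have cols: "column 1 ?z = f1 (x$1) *\<^sub>R e_radial (x$2) + e_axial"
    "column 2 ?z = f (x$1) *\<^sub>R e_angular (x$2)"
    using rotation_surface_columns[OF Df Df1 x(2)] by auto
  note EL = euler_lagrange_rotation[OF f cols C]
  have Phi: "kropina_integrand ?w (normal ?z) \<noteq> 0"
    using kropina_integrand_pos[of ?w "normal ?z"] EL(1) by (simp add: transversal_def)
  have "mean_curvature (kropina_metric b \<theta>) (admissible b \<theta>) (rotation_surface f) (\<lambda>_. e_radial (x$2)) x = 0"
    using min x induced_cone_nonempty[OF p3 \<open>b \<noteq> 0\<close> EL(1)] unfolding minimal_def by blast
  then have "(\<Sum>\<epsilon>\<in>UNIV. \<Sum>\<eta>\<in>UNIV. d2density ?w ?z (colmat \<epsilon> (e_radial (x$2)))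
      (colmat \<eta> (\<chi> j. partial \<epsilon> (partial \<eta> (\<lambda>x. rotation_surface f x $ j)) x))) = 0"
    unfolding mean_curvature_kropina[OF p3 \<open>b \<noteq> 0\<close> EL(1)] using Phi by simp
  then have "rotation_residual (1 + (f1 (x$1))\<^sup>2) (f (x$1) * f2 (x$1)) ((cos (x$2 - \<theta>))\<^sup>2)
      / (sqrt (1 + (f1 (x$1))\<^sup>2) * (1 + (f1 (x$1))\<^sup>2 - (cos (x$2 - \<theta>))\<^sup>2) ^ 3) = 0"
    unfolding sum_2 rotation_surface_second_partials[OF Df Df1 x(2)] EL(2) .
  moreover have "sqrt (1 + (f1 (x$1))\<^sup>2) \<noteq> 0"
    by (metis add_pos_nonneg less_irrefl real_sqrt_gt_zero zero_le_power2 zero_less_one)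
  ultimately show ?thesis using C by simp
qed

section \<open>Incompatibility along a parallel\<close>

lemma quadratic_three_zeros:
  fixes p0 p1 p2 :: real
  assumes "\<And>C. C \<in> {x, y, z} \<Longrightarrow> p0 + p1 * C + p2 * C\<^sup>2 = 0" and "x \<noteq> y" "y \<noteq> z" "x \<noteq> z"
  shows "p0 = 0" "p2 = 0"
proof -
  have eq: "p0 + p1 * x + p2 * x\<^sup>2 = 0" "p0 + p1 * y + p2 * y\<^sup>2 = 0" "p0 + p1 * z + p2 * z\<^sup>2 = 0"
    using assms(1) by auto
  have "(x - y) * (p1 + p2 * (x + y)) = 0" "(x - z) * (p1 + p2 * (x + z)) = 0"
    using eq by (simp_all add: algebra_simps power2_eq_square)
  then have *: "p1 + p2 * (x + y) = 0" "p1 + p2 * (x + z) = 0" using assms by auto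
  then have "p2 * y = p2 * z" unfolding distrib_left by linarith
  then show "p2 = 0" using assms by simp
  with * have "p1 = 0" by simp
  with \<open>p2 = 0\<close> eq show "p0 = 0" by simp
qed

text \<open>The residual is quadratic in \<open>C\<close>. For \<open>\<rho> \<ge> 1\<close>, its constant coefficient vanishes only if
  \<open>\<kappa> = 3 \<rho>\<close>, and its leading coefficient only if \<open>\<kappa> = - \<rho>\<close>.\<close>

lemma residual_not_three_zeros:
  assumes "\<rho> \<ge> 1" and "x \<noteq> y" "y \<noteq> z" "x \<noteq> z"
    and "\<And>C. C \<in> {x, y, z} \<Longrightarrow> rotation_residual \<rho> \<kappa> C = 0"
  shows False
proof -
  have "rotation_residual \<rho> \<kappa> C = \<rho>\<^sup>2 * (\<kappa> - 3 * \<rho>)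
      + (\<kappa> * (2 * \<rho>\<^sup>2 - 6 * \<rho>) - \<rho> * (2 * \<rho> - 2 * \<rho>\<^sup>2)) * C
      + (6 * \<rho> - 3) * (\<kappa> + \<rho>) * C\<^sup>2" for C
    by (simp add: rotation_residual_def algebra_simps power2_eq_square)
  then have "\<rho>\<^sup>2 * (\<kappa> - 3 * \<rho>) = 0" "(6 * \<rho> - 3) * (\<kappa> + \<rho>) = 0"
    using quadratic_three_zeros[of x y z, OF _ assms(2-4)] assms(5) by metis+
  then show False using \<open>\<rho> \<ge> 1\<close> by auto
qed

text \<open>Injectivity follows from \<open>cos\<^sup>2 x - cos\<^sup>2 y = sin (x + y) sin (y - x)\<close>: on a quarter period neither
  argument on the right is a multiple of \<open>\<pi>\<close>.\<close>

lemma cos_squared_quarter_period: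
  fixes x y :: real and k :: int
  assumes "k * (pi / 2) < x" "x < (k + 1) * (pi / 2)"
  shows "(cos x)\<^sup>2 < 1"
    and "k * (pi / 2) < y \<Longrightarrow> y < (k + 1) * (pi / 2) \<Longrightarrow> x \<noteq> y \<Longrightarrow> (cos x)\<^sup>2 \<noteq> (cos y)\<^sup>2"
proof -
  have no_zero: "sin t \<noteq> 0" if "m * pi < t" "t < (m + 1) * pi" for t and m :: int
  proof
    assume "sin t = 0"
    then obtain i :: int where "t = i * pi" by (auto simp: sin_zero_iff_int2)
    with that have "m < i" "i < m + 1" by (simp_all only: mult_less_cancel_right_pos pi_gt_zero of_int_less_iff)
    then show False by linarith
  qed
  have "sin (2 * x) \<noteq> 0"
    using no_zero[of k "2 * x"] assms by (simp add: field_simps)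
  then have "sin x \<noteq> 0" by (simp add: sin_double)
  then show "(cos x)\<^sup>2 < 1" by (simp add: cos_squared_eq)
  assume y: "k * (pi / 2) < y" "y < (k + 1) * (pi / 2)" "x \<noteq> y"
  have "sin (x + y) \<noteq> 0"
    using no_zero[of k "x + y"] assms y by (simp add: field_simps)
  moreover
  have "\<bar>y - x\<bar> < pi / 2"
  proof -
    have "(k + 1) * (pi / 2) = k * (pi / 2) + pi / 2" by (simp add: algebra_simps)
    then show ?thesis using assms y by linarith
  qed
  then have "sin (y - x) \<noteq> 0"
    using no_zero[of 0 "y - x"] no_zero[of "-1" "y - x"] y(3) pi_gt_zero
    by (cases "y > x") auto
  moreover have "(cos x)\<^sup>2 - (cos y)\<^sup>2 = sin (x + y) * sin (y - x)"
  proof -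
    have half: "(2 * x + 2 * y) / 2 = x + y" "(2 * y - 2 * x) / 2 = y - x" by simp_all
    show ?thesis
      using cos_diff_cos[of "2 * x" "2 * y"] unfolding cos_double_cos half by simp
  qed
  ultimately show "(cos x)\<^sup>2 \<noteq> (cos y)\<^sup>2" by auto
qed

text \<open>The three points are spread over the part of the interval that lies in the same quarter period
  as \<open>\<psi>\<close>, where the squared cosine is injective.\<close>

lemma three_cos_squared_values:
  fixes \<psi> e :: real
  assumes "e > 0"
  obtains x y z where "{x, y, z} \<subseteq> {\<psi><..<\<psi> + e}" "\<forall>s\<in>{x, y, z}. (cos s)\<^sup>2 < 1"
    "(cos x)\<^sup>2 \<noteq> (cos y)\<^sup>2" "(cos y)\<^sup>2 \<noteq> (cos z)\<^sup>2" "(cos x)\<^sup>2 \<noteq> (cos z)\<^sup>2"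
proof -
  define k where "k = \<lfloor>\<psi> / (pi / 2)\<rfloor>"
  define d where "d = min e ((k + 1) * (pi / 2) - \<psi>)"
  have "of_int k \<le> \<psi> / (pi / 2)" "\<psi> / (pi / 2) < of_int k + 1"
    unfolding k_def by linarith+
  then have k: "k * (pi / 2) \<le> \<psi>" "\<psi> < (k + 1) * (pi / 2)"
    by (simp_all add: field_simps)
  then have d: "0 < d" "d \<le> e" "\<psi> + d \<le> (k + 1) * (pi / 2)"
    using assms unfolding d_def by linarith+
  have "k * (pi / 2) < s \<and> s < (k + 1) * (pi / 2)" if "s \<in> {\<psi> + d/4, \<psi> + d/2, \<psi> + 3*d/4}" for s
    using that k d by auto
  note q = cos_squared_quarter_period[OF conjunct1[OF this] conjunct2[OF this]]
  show thesis
    by (rule that[of "\<psi> + d/4" "\<psi> + d/2" "\<psi> + 3*d/4"]) (use d q k in auto)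
qed

lemma smooth_on_twice_differentiable:
  fixes f :: "real \<Rightarrow> real"
  assumes "smooth_on S f" "open S"
  obtains f1 f2 where "\<And>t. t \<in> S \<Longrightarrow> (f has_real_derivative f1 t) (at t)"
    "\<And>t. t \<in> S \<Longrightarrow> (f1 has_real_derivative f2 t) (at t)"
proof -
  have deriv: "(g has_real_derivative dir_deriv 1 g t) (at t)"
    if "g differentiable_on S" "t \<in> S" for g :: "real \<Rightarrow> real" and t
  proof -
    have "g differentiable at t"
      using that assms(2) differentiable_on_eq_differentiable_at by blast
    then obtain D where D: "(g has_real_derivative D) (at t)"
      by (auto simp: real_differentiable_def)
    then have "dir_deriv 1 g t = D"
      using dir_deriv_eqI[OF D[unfolded has_field_derivative_def]] by simp
    with D show ?thesis by simp
  qed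
  have "Ck_on 2 S f" using assms(1) by (simp add: smooth_on_def)
  then have "f differentiable_on S" "dir_deriv 1 f differentiable_on S"
    by (simp_all add: eval_nat_numeral)
  then show thesis using that deriv by blast
qed

theorem theorem1p2:
  fixes b \<theta> :: real and f :: "real \<Rightarrow> real" and M :: "(real^2) set"
  assumes "b \<noteq> 0" and "0 \<le> \<theta>" and "\<theta> < 2 * pi"
    and "smooth_on {0<..} f" and "\<And>t. t > 0 \<Longrightarrow> f t > 0"
    and "open M" and "M \<noteq> {}" and "M \<subseteq> {x. x $ 1 > 0}"
    and "immersion M H3 (rotation_surface f)"
  shows "\<not> minimal (kropina hyp_alpha (hyp_beta b \<theta>)) (kropina_cone (hyp_beta b \<theta>)) M
            (rotation_surface f)"
proof
  assume min: "minimal (kropina_metric b \<theta>) (admissible b \<theta>) M (rotation_surface f)"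
  obtain f1 f2 where Df: "\<forall>t>0. (f has_real_derivative f1 t) (at t)"
    and Df1: "\<forall>t>0. (f1 has_real_derivative f2 t) (at t)"
    using smooth_on_twice_differentiable[OF assms(4)] by auto
  obtain x0 where "x0 \<in> M" using assms(7) by blast
  then obtain e where e: "e > 0" "ball x0 e \<subseteq> M" using assms(6) by (meson openE)
  define t where "t = x0 $ 1"
  have t: "t > 0" using \<open>x0 \<in> M\<close> assms(8) by (auto simp: t_def)
  let ?\<rho> = "1 + (f1 t)\<^sup>2"
  have residual: "rotation_residual ?\<rho> (f t * f2 t) ((cos \<psi>)\<^sup>2) = 0"
    if "x0 $ 2 - \<theta> < \<psi>" "\<psi> < x0 $ 2 - \<theta> + e" "(cos \<psi>)\<^sup>2 < 1" for \<psi>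
  proof -
    define x :: "real^2" where "x = vector [t, \<psi> + \<theta>]"
    have "dist x0 x = \<bar>\<psi> + \<theta> - x0 $ 2\<bar>"
      by (simp add: x_def t_def dist_norm norm_vec_def L2_set_def sum_2 abs_minus_commute)
    then have "x \<in> M" using e that by auto
    moreover have "(cos \<psi>)\<^sup>2 < ?\<rho>" using that(3) by (smt (verit) zero_le_power2)
    ultimately show ?thesis
      using minimal_imp_residual_zero[OF Df Df1 min, of x] t assms(1,5) by (simp add: x_def)
  qed
  \<comment> \<open>On the parallel through \<open>x0\<close> the profile data are fixed while the angle varies freely.\<close>
  obtain x y z where "{x, y, z} \<subseteq> {x0 $ 2 - \<theta><..<x0 $ 2 - \<theta> + e}" "\<forall>s\<in>{x, y, z}. (cos s)\<^sup>2 < 1"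
    "(cos x)\<^sup>2 \<noteq> (cos y)\<^sup>2" "(cos y)\<^sup>2 \<noteq> (cos z)\<^sup>2" "(cos x)\<^sup>2 \<noteq> (cos z)\<^sup>2"
    using e(1) by (rule three_cos_squared_values)
  then show False
    using residual residual_not_three_zeros[of ?\<rho> "(cos x)\<^sup>2" "(cos y)\<^sup>2" "(cos z)\<^sup>2" "f t * f2 t"] by auto
qed

end
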